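(* Let $R/S$ be a Frobenius extension with Frobenius system $\{E,x_i,y_i\}$, and let $G:\ {}_S\mathcal{M}_R\to {}_S\mathcal{M}_S$ be the restriction of scalars functor. Then $E:\ R\to S$ is a right $\mathrm{Im}(G)$-approximation of ${}_SS_S$.
   Context: Rings are associative with unit. A ring extension $R/S$ is a ring homomorphism $S\to R$, making $R$ an $S$-bimodule. It is a Frobenius extension with Frobenius system $\{E,x_i,y_i\}$ if $E:\ R\to S$ is an $S$-bimodule map and $x_1,\dots,x_n,y_1,\dots,y_n\in R$ satisfy $\sum_i x_iE(y_ir)=r=\sum_i E(rx_i)y_i$ for all $r\in R$. ${}_S\mathcal{M}_R$ is the category of $(S,R)$-bimodules. $\mathrm{Im}(G)$ is the full subcategory of ${}_S\mathcal{M}_S$ consisting of objects of the form $G(N)$, $N\in {}_S\mathcal{M}_R$. For a full subcategory $\mathcal{E}$ of $\mathcal{D}$ and $X\in\mathcal{D}$, a right $\mathcal{E}$-approximation of $X$ is a morphism $f:\ X_1\to X$ in $\mathcal{D}$ with $X_1\in\mathcal{E}$ such that every morphism $Y\to X$ with $Y\in\mathcal{E}$ factors through $f$. *)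

theory Defs
  imports "HOL-Algebra.RingHom" "HOL-Algebra.Module"
begin

text \<open>
  As for \<open>module\<close> in HOL-Algebra, the additive group of a bimodule is stored in a
  \<open>ring\<close> record, whose multiplication and unit carry no meaning and are never used.
\<close>

record ('a, 'b, 'c) bimodule = "('a, 'c) module" +
  rsmult :: "['c, 'b] \<Rightarrow> 'c" (infixl \<open>\<star>\<index>\<close> 70)

locale bimodule = S?: ring S + T?: ring T + M?: abelian_group M
  for S :: "('a, 'p) ring_scheme" (structure)
    and T :: "('b, 'q) ring_scheme" (structure)
    and M :: "('a, 'b, 'c) bimodule" (structure) +
  assumes smult_closed:
      "\<lbrakk>a \<in> carrier S; x \<in> carrier M\<rbrakk> \<Longrightarrow> a \<odot>\<^bsub>M\<^esub> x \<in> carrier M"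
    and smult_l_distr:
      "\<lbrakk>a \<in> carrier S; b \<in> carrier S; x \<in> carrier M\<rbrakk>
        \<Longrightarrow> (a \<oplus>\<^bsub>S\<^esub> b) \<odot>\<^bsub>M\<^esub> x = a \<odot>\<^bsub>M\<^esub> x \<oplus>\<^bsub>M\<^esub> b \<odot>\<^bsub>M\<^esub> x"
    and smult_r_distr:
      "\<lbrakk>a \<in> carrier S; x \<in> carrier M; y \<in> carrier M\<rbrakk>
        \<Longrightarrow> a \<odot>\<^bsub>M\<^esub> (x \<oplus>\<^bsub>M\<^esub> y) = a \<odot>\<^bsub>M\<^esub> x \<oplus>\<^bsub>M\<^esub> a \<odot>\<^bsub>M\<^esub> y"
    and smult_assoc:
      "\<lbrakk>a \<in> carrier S; b \<in> carrier S; x \<in> carrier M\<rbrakk>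
        \<Longrightarrow> (a \<otimes>\<^bsub>S\<^esub> b) \<odot>\<^bsub>M\<^esub> x = a \<odot>\<^bsub>M\<^esub> (b \<odot>\<^bsub>M\<^esub> x)"
    and smult_one:
      "x \<in> carrier M \<Longrightarrow> \<one>\<^bsub>S\<^esub> \<odot>\<^bsub>M\<^esub> x = x"
    and rsmult_closed:
      "\<lbrakk>x \<in> carrier M; c \<in> carrier T\<rbrakk> \<Longrightarrow> x \<star>\<^bsub>M\<^esub> c \<in> carrier M"
    and rsmult_l_distr:
      "\<lbrakk>x \<in> carrier M; y \<in> carrier M; c \<in> carrier T\<rbrakk>
        \<Longrightarrow> (x \<oplus>\<^bsub>M\<^esub> y) \<star>\<^bsub>M\<^esub> c = x \<star>\<^bsub>M\<^esub> c \<oplus>\<^bsub>M\<^esub> y \<star>\<^bsub>M\<^esub> c"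
    and rsmult_r_distr:
      "\<lbrakk>x \<in> carrier M; c \<in> carrier T; d \<in> carrier T\<rbrakk>
        \<Longrightarrow> x \<star>\<^bsub>M\<^esub> (c \<oplus>\<^bsub>T\<^esub> d) = x \<star>\<^bsub>M\<^esub> c \<oplus>\<^bsub>M\<^esub> x \<star>\<^bsub>M\<^esub> d"
    and rsmult_assoc:
      "\<lbrakk>x \<in> carrier M; c \<in> carrier T; d \<in> carrier T\<rbrakk>
        \<Longrightarrow> x \<star>\<^bsub>M\<^esub> (c \<otimes>\<^bsub>T\<^esub> d) = (x \<star>\<^bsub>M\<^esub> c) \<star>\<^bsub>M\<^esub> d"
    and rsmult_one:
      "x \<in> carrier M \<Longrightarrow> x \<star>\<^bsub>M\<^esub> \<one>\<^bsub>T\<^esub> = x"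
    and smult_rsmult:
      "\<lbrakk>a \<in> carrier S; x \<in> carrier M; c \<in> carrier T\<rbrakk>
        \<Longrightarrow> (a \<odot>\<^bsub>M\<^esub> x) \<star>\<^bsub>M\<^esub> c = a \<odot>\<^bsub>M\<^esub> (x \<star>\<^bsub>M\<^esub> c)"

definition bimodules ::
    "('a, 'p) ring_scheme \<Rightarrow> ('b, 'q) ring_scheme \<Rightarrow> ('a, 'b, 'c) bimodule set"
  where "bimodules S T = {M. bimodule S T M}"

text \<open>
  Following the convention for \<open>hom\<close>, morphisms are functions whose values outside the
  carrier are irrelevant, so two of them are equal when they agree on the carrier.
\<close>

definition bimodule_hom ::
    "('a, 'p) ring_scheme \<Rightarrow> ('b, 'q) ring_scheme
      \<Rightarrow> ('a, 'b, 'c) bimodule \<Rightarrow> ('a, 'b, 'd) bimodule \<Rightarrow> ('c \<Rightarrow> 'd) set"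
  where "bimodule_hom S T M N =
    {f \<in> hom (add_monoid M) (add_monoid N).
      (\<forall>a\<in>carrier S. \<forall>x\<in>carrier M. f (a \<odot>\<^bsub>M\<^esub> x) = a \<odot>\<^bsub>N\<^esub> f x) \<and>
      (\<forall>x\<in>carrier M. \<forall>c\<in>carrier T. f (x \<star>\<^bsub>M\<^esub> c) = f x \<star>\<^bsub>N\<^esub> c)}"

text \<open>
  \<open>ring_bimodule R f g\<close> is \<open>R\<close> with left scalars acting through \<open>f\<close> and right scalars
  acting through \<open>g\<close>.
\<close>

definition ring_bimodule ::
    "('c, 'p) ring_scheme \<Rightarrow> ('a \<Rightarrow> 'c) \<Rightarrow> ('b \<Rightarrow> 'c) \<Rightarrow> ('a, 'b, 'c) bimodule"
  where "ring_bimodule R f g =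
    \<lparr>carrier = carrier R, monoid.mult = monoid.mult R, one = one R, ring.zero = ring.zero R, add = add R,
     smult = (\<lambda>a r. f a \<otimes>\<^bsub>R\<^esub> r), rsmult = (\<lambda>r b. r \<otimes>\<^bsub>R\<^esub> g b)\<rparr>"

text \<open>
  A ring extension is a ring homomorphism \<open>\<phi>\<close> from \<open>S\<close> to \<open>R\<close>, not necessarily injective;
  elements of \<open>S\<close> are moved into \<open>R\<close> by \<open>\<phi>\<close>.
\<close>

locale frobenius_extension = ring_hom_ring S R \<phi>
  for S :: "('s, 'p) ring_scheme" (structure)
    and R :: "('r, 'q) ring_scheme" (structure)
    and \<phi> :: "'s \<Rightarrow> 'r" +
  fixes E :: "'r \<Rightarrow> 's" and n :: nat and x y :: "nat \<Rightarrow> 'r"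
  assumes E_hom: "E \<in> bimodule_hom S S (ring_bimodule R \<phi> \<phi>) (ring_bimodule S id id)"
    and x_closed: "x \<in> {1..n} \<rightarrow> carrier R"
    and y_closed: "y \<in> {1..n} \<rightarrow> carrier R"
    and left_dual_basis:
      "r \<in> carrier R \<Longrightarrow> (\<Oplus>\<^bsub>R\<^esub>i\<in>{1..n}. x i \<otimes>\<^bsub>R\<^esub> \<phi> (E (y i \<otimes>\<^bsub>R\<^esub> r))) = r"
    and right_dual_basis:
      "r \<in> carrier R \<Longrightarrow> (\<Oplus>\<^bsub>R\<^esub>i\<in>{1..n}. \<phi> (E (r \<otimes>\<^bsub>R\<^esub> x i)) \<otimes>\<^bsub>R\<^esub> y i) = r"

text \<open>
  The object map of the restriction of scalars functor from (S,R)-bimodules to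
  (S,S)-bimodules; on morphisms this functor leaves the underlying function unchanged.
\<close>

definition restrict_scalars ::
    "('s \<Rightarrow> 'r) \<Rightarrow> ('s, 'r, 'c) bimodule \<Rightarrow> ('s, 's, 'c) bimodule"
  where "restrict_scalars \<phi> N =
    \<lparr>carrier = carrier N, monoid.mult = monoid.mult N, one = one N, ring.zero = ring.zero N, add = add N,
     smult = smult N, rsmult = (\<lambda>x s. x \<star>\<^bsub>N\<^esub> \<phi> s)\<rparr>"

definition restriction_image ::
    "('s, 'p) ring_scheme \<Rightarrow> ('r, 'q) ring_scheme \<Rightarrow> ('s \<Rightarrow> 'r) \<Rightarrow> ('s, 's, 'c) bimodule set"
  where "restriction_image S R \<phi> = restrict_scalars \<phi> ` bimodules S R"

text \<open>
  \<open>f : X1 \<rightarrow> X\<close> is a right approximation of \<open>X\<close>, in the category of (S,T)-bimodules, by a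
  full subcategory (given by its objects).  Since a HOL set has members of a single type,
  the subcategory is passed twice: as \<open>E1\<close>, its objects on the type of \<open>X1\<close>, and as \<open>E2\<close>,
  its objects on the type of the test objects \<open>Y\<close>.  A class of bimodules defined for all
  carrier types is to be supplied for both, leaving the second type arbitrary.
\<close>

definition right_approximation ::
    "('a, 'p) ring_scheme \<Rightarrow> ('b, 'q) ring_scheme
      \<Rightarrow> ('a, 'b, 'c) bimodule set \<Rightarrow> ('a, 'b, 'd) bimodule set
      \<Rightarrow> ('a, 'b, 'c) bimodule \<Rightarrow> ('a, 'b, 'e) bimodule \<Rightarrow> ('c \<Rightarrow> 'e) \<Rightarrow> bool"
  where "right_approximation S T E1 E2 X1 X f \<longleftrightarrow>
    E1 \<subseteq> bimodules S T \<and> E2 \<subseteq> bimodules S T \<and>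
    X \<in> bimodules S T \<and> X1 \<in> E1 \<and> f \<in> bimodule_hom S T X1 X \<and>
    (\<forall>Y\<in>E2. \<forall>g\<in>bimodule_hom S T Y X.
      \<exists>h\<in>bimodule_hom S T Y X1. \<forall>y\<in>carrier Y. g y = f (h y))"

end

theory Submission
  imports Defs
begin

text \<open>
  Given an (S,R)-bimodule \<open>N\<close> and an (S,S)-bimodule map \<open>g\<close> from \<open>N\<close> to \<open>S\<close>, the map
  \<open>v \<mapsto> \<Sum>i. g (v x\<^sub>i) y\<^sub>i\<close> lifts \<open>g\<close> along \<open>E\<close>: applying \<open>E\<close> gives
  \<open>\<Sum>i. g (v x\<^sub>i) E y\<^sub>i = g (v \<Sum>i. x\<^sub>i E y\<^sub>i) = g v\<close>.  It is even right \<open>R\<close>-linear, because both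
  dual basis identities give \<open>\<Sum>j. r x\<^sub>j \<otimes> y\<^sub>j = \<Sum>i. x\<^sub>i \<otimes> y\<^sub>i r\<close> in \<open>R \<otimes>\<^sub>S R\<close>.
\<close>

text \<open>Additivity is required on the carrier alone, so that one rule serves
  \<open>\<phi>\<close>, \<open>E\<close> and the map sending \<open>r\<close> to
  \<open>g (v \<star> r)\<close>.\<close>

lemma finsum_additive:
  assumes "abelian_group M" "abelian_group N"
    and closed: "\<And>u. u \<in> carrier M \<Longrightarrow> f u \<in> carrier N"
    and add: "\<And>u v. \<lbrakk>u \<in> carrier M; v \<in> carrier M\<rbrakk> \<Longrightarrow> f (u \<oplus>\<^bsub>M\<^esub> v) = f u \<oplus>\<^bsub>N\<^esub> f v"
    and k: "\<And>i. i \<in> I \<Longrightarrow> k i \<in> carrier M"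
  shows "f (\<Oplus>\<^bsub>M\<^esub>i\<in>I. k i) = (\<Oplus>\<^bsub>N\<^esub>i\<in>I. f (k i))"
proof -
  interpret M: abelian_group M by fact
  interpret N: abelian_group N by fact
  \<comment> \<open>Preservation of zero follows by cancellation in the group \<open>N\<close>. It
    settles the empty sum and also an infinite \<open>I\<close>, where both sums are zero by
    convention.\<close>
  have zero: "f \<zero>\<^bsub>M\<^esub> = \<zero>\<^bsub>N\<^esub>"
    by (metis M.zero_closed M.r_zero N.add.r_cancel_one closed add)
  show ?thesis
    using k
  proof (induction I rule: infinite_finite_induct)
    case (insert i I)
    have "k \<in> I \<rightarrow> carrier M" "(\<lambda>i. f (k i)) \<in> I \<rightarrow> carrier N"
      using insert.prems closed by auto
    then show ?case
      using insert closed by (simp add: add)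
  qed (simp_all add: zero)
qed

text \<open>Induction over \<open>I\<close> reduces the interchange to additivity of the sum over
  \<open>J\<close>.\<close>

lemma (in abelian_monoid) finsum_swap:
  assumes "\<And>i j. \<lbrakk>i \<in> I; j \<in> J\<rbrakk> \<Longrightarrow> k i j \<in> carrier G"
  shows "(\<Oplus>i\<in>I. \<Oplus>j\<in>J. k i j) = (\<Oplus>j\<in>J. \<Oplus>i\<in>I. k i j)"
  using assms
proof (induction I rule: infinite_finite_induct)
  case (insert i I)
  have c: "(\<lambda>i. \<Oplus>j\<in>J. k i j) \<in> I \<rightarrow> carrier G" "(\<Oplus>j\<in>J. k i j) \<in> carrier G"
    "k i \<in> J \<rightarrow> carrier G" "(\<lambda>j. \<Oplus>i\<in>I. k i j) \<in> J \<rightarrow> carrier G"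
    using insert.prems by (auto intro!: finsum_closed)
  have "(\<Oplus>j\<in>J. \<Oplus>i\<in>insert i I. k i j) = (\<Oplus>j\<in>J. k i j \<oplus> (\<Oplus>i\<in>I. k i j))"
    using insert.prems insert.hyps by (intro finsum_cong') (auto intro!: finsum_closed finsum_insert)
  also have "\<dots> = (\<Oplus>j\<in>J. k i j) \<oplus> (\<Oplus>j\<in>J. \<Oplus>i\<in>I. k i j)"
    using c by (simp add: finsum_addf)
  finally show ?case
    using insert c by simp
qed simp_all

text \<open>Two independent homomorphisms are allowed so that both \<open>R\<close> as an
  (S,R)-bimodule, with \<open>\<phi>\<close> and \<open>id\<close>, and \<open>S\<close> over
  itself, with \<open>id\<close> twice, are instances.\<close>

lemma bimodule_ring_bimodule:
  assumes "ring_hom_ring S R f" "ring_hom_ring T R g"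
  shows "bimodule S T (ring_bimodule R f g)"
proof -
  interpret f: ring_hom_ring S R f by fact
  interpret g: ring_hom_ring T R g by fact
  have "abelian_group (ring_bimodule R f g)"
    using abelian_groupE[OF f.S.is_abelian_group]
    by (intro abelian_groupI) (simp_all add: ring_bimodule_def)
  then show ?thesis
    \<comment> \<open>The qualifiers follow \<open>ring_hom_ring\<close>, where \<open>R\<close> is
      the source and \<open>S\<close> the target: \<open>f.R\<close> concerns the ring
      \<open>S\<close>, while \<open>f.S\<close> concerns the ring \<open>R\<close>.\<close>
    by (intro bimodule.intro bimodule_axioms.intro f.R.ring_axioms g.R.ring_axioms)
      (simp_all add: ring_bimodule_def f.S.l_distr f.S.r_distr f.S.m_assoc)
qed

lemma bimodule_restrict_scalars:
  assumes "ring_hom_ring S R \<phi>" "bimodule S R N"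
  shows "bimodule S S (restrict_scalars \<phi> N)"
proof -
  interpret h: ring_hom_ring S R \<phi> by fact
  interpret N: bimodule S R N by fact
  have "abelian_group (restrict_scalars \<phi> N)"
    using abelian_groupE[OF N.M.abelian_group_axioms]
    by (intro abelian_groupI) (simp_all add: restrict_scalars_def)
  then show ?thesis
    by (intro bimodule.intro bimodule_axioms.intro h.R.ring_axioms)
      (simp_all add: restrict_scalars_def N.smult_closed N.smult_l_distr N.smult_r_distr
        N.smult_assoc N.smult_one N.rsmult_closed N.rsmult_l_distr N.rsmult_r_distr
        N.rsmult_assoc N.rsmult_one N.smult_rsmult)
qed

lemma restriction_image_subset_bimodules:
  "ring_hom_ring S R \<phi> \<Longrightarrow> restriction_image S R \<phi> \<subseteq> bimodules S S"
  using bimodule_restrict_scalars by (fastforce simp: restriction_image_def bimodules_def)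

text \<open>This places the domain of \<open>E\<close> in the image of restriction: it is the
  regular right \<open>R\<close>-module, with \<open>S\<close> acting on the left, restricted along
  \<open>\<phi>\<close>.\<close>

lemma restrict_scalars_ring_bimodule:
  "restrict_scalars \<phi> (ring_bimodule R f id) = ring_bimodule R f \<phi>"
  by (simp add: restrict_scalars_def ring_bimodule_def)

lemma ring_hom_ring_id: "ring R \<Longrightarrow> ring_hom_ring R R id"
  by (rule ring_hom_ringI) auto

context frobenius_extension
begin

lemma E_closed [simp]: "r \<in> carrier R \<Longrightarrow> E r \<in> carrier S"
  and E_add: "\<lbrakk>r \<in> carrier R; r' \<in> carrier R\<rbrakk> \<Longrightarrow> E (r \<oplus>\<^bsub>R\<^esub> r') = E r \<oplus>\<^bsub>S\<^esub> E r'"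
  and E_smult: "\<lbrakk>a \<in> carrier S; r \<in> carrier R\<rbrakk> \<Longrightarrow> E (\<phi> a \<otimes>\<^bsub>R\<^esub> r) = a \<otimes>\<^bsub>S\<^esub> E r"
  using E_hom by (auto simp: bimodule_hom_def ring_bimodule_def hom_def)

lemma x_carrier [simp]: "i \<in> {1..n} \<Longrightarrow> x i \<in> carrier R"
  and y_carrier [simp]: "i \<in> {1..n} \<Longrightarrow> y i \<in> carrier R"
  using x_closed y_closed by auto

context
  fixes N :: "('s, 'r, 'c) bimodule" and g :: "'c \<Rightarrow> 's"
  assumes N: "bimodule S R N"
    and g: "g \<in> bimodule_hom S S (restrict_scalars \<phi> N) (ring_bimodule S id id)"
begin

interpretation N: bimodule S R N
  by (rule N)

lemma g_closed: "v \<in> carrier N \<Longrightarrow> g v \<in> carrier S"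
  and g_add: "\<lbrakk>v \<in> carrier N; w \<in> carrier N\<rbrakk> \<Longrightarrow> g (v \<oplus>\<^bsub>N\<^esub> w) = g v \<oplus>\<^bsub>S\<^esub> g w"
  and g_smult: "\<lbrakk>a \<in> carrier S; v \<in> carrier N\<rbrakk> \<Longrightarrow> g (a \<odot>\<^bsub>N\<^esub> v) = a \<otimes>\<^bsub>S\<^esub> g v"
  and g_rsmult: "\<lbrakk>v \<in> carrier N; a \<in> carrier S\<rbrakk> \<Longrightarrow> g (v \<star>\<^bsub>N\<^esub> \<phi> a) = g v \<otimes>\<^bsub>S\<^esub> a"
  using g by (auto simp: bimodule_hom_def ring_bimodule_def restrict_scalars_def hom_def)

text \<open>The left dual basis identity expands \<open>r\<close>, and right
  \<open>S\<close>-linearity of \<open>g\<close> pulls out the coefficients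
  \<open>E (y i r)\<close>. The cases of interest are \<open>r x j\<close>, for linearity of the
  lift, and the unit, for the factorization through \<open>E\<close>.\<close>

lemma g_rsmult_expand:
  assumes "v \<in> carrier N" "r \<in> carrier R"
  shows "g (v \<star>\<^bsub>N\<^esub> r) = (\<Oplus>\<^bsub>S\<^esub>i\<in>{1..n}. g (v \<star>\<^bsub>N\<^esub> x i) \<otimes>\<^bsub>S\<^esub> E (y i \<otimes>\<^bsub>R\<^esub> r))"
proof -
  have "g (v \<star>\<^bsub>N\<^esub> r) = g (v \<star>\<^bsub>N\<^esub> (\<Oplus>\<^bsub>R\<^esub>i\<in>{1..n}. x i \<otimes>\<^bsub>R\<^esub> \<phi> (E (y i \<otimes>\<^bsub>R\<^esub> r))))"
    using assms by (simp only: left_dual_basis)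
  also have "\<dots> = (\<Oplus>\<^bsub>S\<^esub>i\<in>{1..n}. g (v \<star>\<^bsub>N\<^esub> (x i \<otimes>\<^bsub>R\<^esub> \<phi> (E (y i \<otimes>\<^bsub>R\<^esub> r)))))"
    using assms
    by (intro finsum_additive[where f = "\<lambda>r. g (v \<star>\<^bsub>N\<^esub> r)"])
      (auto simp: S.is_abelian_group R.is_abelian_group N.rsmult_closed N.rsmult_r_distr g_closed g_add)
  also have "\<dots> = (\<Oplus>\<^bsub>S\<^esub>i\<in>{1..n}. g (v \<star>\<^bsub>N\<^esub> x i) \<otimes>\<^bsub>S\<^esub> E (y i \<otimes>\<^bsub>R\<^esub> r))"
    using assms
    \<comment> \<open>As inherited from \<open>ring_hom_ring\<close>, \<open>R.finsum_cong'\<close>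
      is about sums in the source ring \<open>S\<close>.\<close>
    by (intro R.finsum_cong') (auto simp: N.rsmult_closed N.rsmult_assoc g_closed g_rsmult)
  finally show ?thesis .
qed

text \<open>The formula is the right dual basis expansion with \<open>E (r x i)\<close> replaced by
  \<open>g (v x i)\<close>. For \<open>N\<close> the ring \<open>R\<close> itself and
  \<open>g = E\<close> it therefore gives the identity.\<close>

definition lift :: "'c \<Rightarrow> 'r"
  where "lift v = (\<Oplus>\<^bsub>R\<^esub>i\<in>{1..n}. \<phi> (g (v \<star>\<^bsub>N\<^esub> x i)) \<otimes>\<^bsub>R\<^esub> y i)"

lemma lift_closed: "v \<in> carrier N \<Longrightarrow> lift v \<in> carrier R"
  unfolding lift_def by (auto intro!: S.finsum_closed simp: N.rsmult_closed g_closed)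

lemma lift_add:
  assumes "v \<in> carrier N" "w \<in> carrier N"
  shows "lift (v \<oplus>\<^bsub>N\<^esub> w) = lift v \<oplus>\<^bsub>R\<^esub> lift w"
proof -
  have "lift (v \<oplus>\<^bsub>N\<^esub> w) = (\<Oplus>\<^bsub>R\<^esub>i\<in>{1..n}.
      \<phi> (g (v \<star>\<^bsub>N\<^esub> x i)) \<otimes>\<^bsub>R\<^esub> y i \<oplus>\<^bsub>R\<^esub> \<phi> (g (w \<star>\<^bsub>N\<^esub> x i)) \<otimes>\<^bsub>R\<^esub> y i)"
    unfolding lift_def using assms
    by (intro S.finsum_cong')
      (auto simp: N.rsmult_closed N.rsmult_l_distr g_closed g_add S.l_distr)
  also have "\<dots> = lift v \<oplus>\<^bsub>R\<^esub> lift w"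
    unfolding lift_def using assms
    by (intro S.finsum_addf) (auto simp: N.rsmult_closed g_closed)
  finally show ?thesis .
qed

lemma lift_smult:
  assumes "a \<in> carrier S" "v \<in> carrier N"
  shows "lift (a \<odot>\<^bsub>N\<^esub> v) = \<phi> a \<otimes>\<^bsub>R\<^esub> lift v"
proof -
  have "lift (a \<odot>\<^bsub>N\<^esub> v) = (\<Oplus>\<^bsub>R\<^esub>i\<in>{1..n}. \<phi> a \<otimes>\<^bsub>R\<^esub> (\<phi> (g (v \<star>\<^bsub>N\<^esub> x i)) \<otimes>\<^bsub>R\<^esub> y i))"
    unfolding lift_def using assms
    by (intro S.finsum_cong')
      (auto simp: N.rsmult_closed N.smult_rsmult g_closed g_smult S.m_assoc)
  also have "\<dots> = \<phi> a \<otimes>\<^bsub>R\<^esub> lift v"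
    unfolding lift_def using assms
    by (intro S.finsum_rdistr[symmetric]) (auto simp: N.rsmult_closed g_closed)
  finally show ?thesis .
qed

text \<open>This is the tensor identity for the dual bases carried out on sums: the left identity
  expands each \<open>g (v r x j)\<close>, the two sums are interchanged, and the right identity at
  \<open>y i r\<close> collapses the sum over \<open>j\<close>.\<close>

lemma lift_rsmult:
  assumes v: "v \<in> carrier N" and r: "r \<in> carrier R"
  shows "lift (v \<star>\<^bsub>N\<^esub> r) = lift v \<otimes>\<^bsub>R\<^esub> r"
proof -
  let ?G = "\<lambda>i. \<phi> (g (v \<star>\<^bsub>N\<^esub> x i))"
  \<comment> \<open>The bracketing is the one in which the right dual basis identity applies to
    \<open>y i r\<close>; the expansion of \<open>g\<close> yields \<open>y i (r x j)\<close>, so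
    associativity has to mediate.\<close>
  let ?E = "\<lambda>i j. \<phi> (E ((y i \<otimes>\<^bsub>R\<^esub> r) \<otimes>\<^bsub>R\<^esub> x j))"
  have G: "?G i \<in> carrier R" if "i \<in> {1..n}" for i
    using that v by (simp add: N.rsmult_closed g_closed)
  have E: "?E i j \<in> carrier R" if "i \<in> {1..n}" "j \<in> {1..n}" for i j
    using that r by simp
  have expand: "\<phi> (g ((v \<star>\<^bsub>N\<^esub> r) \<star>\<^bsub>N\<^esub> x j)) = (\<Oplus>\<^bsub>R\<^esub>i\<in>{1..n}. ?G i \<otimes>\<^bsub>R\<^esub> ?E i j)"
    if j: "j \<in> {1..n}" for j
  proof -
    have "g ((v \<star>\<^bsub>N\<^esub> r) \<star>\<^bsub>N\<^esub> x j) = g (v \<star>\<^bsub>N\<^esub> (r \<otimes>\<^bsub>R\<^esub> x j))"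
      using v r j by (simp add: N.rsmult_assoc)
    then have "\<phi> (g ((v \<star>\<^bsub>N\<^esub> r) \<star>\<^bsub>N\<^esub> x j)) =
        \<phi> (\<Oplus>\<^bsub>S\<^esub>i\<in>{1..n}. g (v \<star>\<^bsub>N\<^esub> x i) \<otimes>\<^bsub>S\<^esub> E (y i \<otimes>\<^bsub>R\<^esub> (r \<otimes>\<^bsub>R\<^esub> x j)))"
      using v r j by (simp add: g_rsmult_expand)
    also have "\<dots> = (\<Oplus>\<^bsub>R\<^esub>i\<in>{1..n}. \<phi> (g (v \<star>\<^bsub>N\<^esub> x i) \<otimes>\<^bsub>S\<^esub> E (y i \<otimes>\<^bsub>R\<^esub> (r \<otimes>\<^bsub>R\<^esub> x j))))"
      using v r j
      by (intro finsum_additive)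
        (auto simp: S.is_abelian_group R.is_abelian_group N.rsmult_closed g_closed)
    also have "\<dots> = (\<Oplus>\<^bsub>R\<^esub>i\<in>{1..n}. ?G i \<otimes>\<^bsub>R\<^esub> ?E i j)"
      using v r j G E
      by (intro S.finsum_cong') (auto simp: N.rsmult_closed g_closed S.m_assoc)
    finally show ?thesis .
  qed
  have "lift (v \<star>\<^bsub>N\<^esub> r) = (\<Oplus>\<^bsub>R\<^esub>j\<in>{1..n}. \<Oplus>\<^bsub>R\<^esub>i\<in>{1..n}. ?G i \<otimes>\<^bsub>R\<^esub> (?E i j \<otimes>\<^bsub>R\<^esub> y j))"
    unfolding lift_def
  proof (intro S.finsum_cong' refl)
    fix j assume j: "j \<in> {1..n}"
    have "(\<Oplus>\<^bsub>R\<^esub>i\<in>{1..n}. ?G i \<otimes>\<^bsub>R\<^esub> ?E i j) \<otimes>\<^bsub>R\<^esub> y j =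
        (\<Oplus>\<^bsub>R\<^esub>i\<in>{1..n}. (?G i \<otimes>\<^bsub>R\<^esub> ?E i j) \<otimes>\<^bsub>R\<^esub> y j)"
      using G E j by (intro S.finsum_ldistr) auto
    also have "\<dots> = (\<Oplus>\<^bsub>R\<^esub>i\<in>{1..n}. ?G i \<otimes>\<^bsub>R\<^esub> (?E i j \<otimes>\<^bsub>R\<^esub> y j))"
      using G E j by (intro S.finsum_cong') (auto simp: S.m_assoc)
    finally show "\<phi> (g ((v \<star>\<^bsub>N\<^esub> r) \<star>\<^bsub>N\<^esub> x j)) \<otimes>\<^bsub>R\<^esub> y j =
        (\<Oplus>\<^bsub>R\<^esub>i\<in>{1..n}. ?G i \<otimes>\<^bsub>R\<^esub> (?E i j \<otimes>\<^bsub>R\<^esub> y j))"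
      using j by (simp add: expand)
  qed (use G E in \<open>auto intro!: S.finsum_closed\<close>)
  \<comment> \<open>With \<open>j\<close> as the inner index, \<open>?G i\<close> is constant and
    can be factored out.\<close>
  also have "\<dots> = (\<Oplus>\<^bsub>R\<^esub>i\<in>{1..n}. \<Oplus>\<^bsub>R\<^esub>j\<in>{1..n}. ?G i \<otimes>\<^bsub>R\<^esub> (?E i j \<otimes>\<^bsub>R\<^esub> y j))"
    using G E by (intro S.finsum_swap) auto
  also have "\<dots> = (\<Oplus>\<^bsub>R\<^esub>i\<in>{1..n}. (?G i \<otimes>\<^bsub>R\<^esub> y i) \<otimes>\<^bsub>R\<^esub> r)"
  proof (intro S.finsum_cong' refl)
    fix i assume i: "i \<in> {1..n}"
    have "(\<Oplus>\<^bsub>R\<^esub>j\<in>{1..n}. ?G i \<otimes>\<^bsub>R\<^esub> (?E i j \<otimes>\<^bsub>R\<^esub> y j)) =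
        ?G i \<otimes>\<^bsub>R\<^esub> (\<Oplus>\<^bsub>R\<^esub>j\<in>{1..n}. ?E i j \<otimes>\<^bsub>R\<^esub> y j)"
      using G E i by (intro S.finsum_rdistr[symmetric]) auto
    also have "\<dots> = (?G i \<otimes>\<^bsub>R\<^esub> y i) \<otimes>\<^bsub>R\<^esub> r"
      \<comment> \<open>Keeping \<open>1\<close> unexpanded leaves the index set as
        \<open>{1..n}\<close>, so that \<open>right_dual_basis\<close> still matches.\<close>
      using G r i by (simp add: right_dual_basis S.m_assoc del: One_nat_def)
    finally show "(\<Oplus>\<^bsub>R\<^esub>j\<in>{1..n}. ?G i \<otimes>\<^bsub>R\<^esub> (?E i j \<otimes>\<^bsub>R\<^esub> y j)) = (?G i \<otimes>\<^bsub>R\<^esub> y i) \<otimes>\<^bsub>R\<^esub> r" .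
  qed (use G r in auto)
  also have "\<dots> = lift v \<otimes>\<^bsub>R\<^esub> r"
    unfolding lift_def using G r by (intro S.finsum_ldistr[symmetric]) auto
  finally show ?thesis .
qed

lemma E_lift:
  assumes "v \<in> carrier N"
  shows "E (lift v) = g v"
proof -
  have "E (lift v) = (\<Oplus>\<^bsub>S\<^esub>i\<in>{1..n}. E (\<phi> (g (v \<star>\<^bsub>N\<^esub> x i)) \<otimes>\<^bsub>R\<^esub> y i))"
    unfolding lift_def using assms
    by (intro finsum_additive)
      (auto simp: S.is_abelian_group R.is_abelian_group N.rsmult_closed g_closed E_add)
  \<comment> \<open>Left \<open>S\<close>-linearity of \<open>E\<close> pulls out the coefficients.
    The unit of \<open>R\<close> is inserted so that the sum becomes the expansion of
    \<open>g\<close> at that unit.\<close>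
  also have "\<dots> = (\<Oplus>\<^bsub>S\<^esub>i\<in>{1..n}. g (v \<star>\<^bsub>N\<^esub> x i) \<otimes>\<^bsub>S\<^esub> E (y i \<otimes>\<^bsub>R\<^esub> \<one>\<^bsub>R\<^esub>))"
    using assms by (intro R.finsum_cong') (auto simp: N.rsmult_closed g_closed E_smult)
  also have "\<dots> = g (v \<star>\<^bsub>N\<^esub> \<one>\<^bsub>R\<^esub>)"
    using assms by (simp only: g_rsmult_expand S.one_closed)
  finally show ?thesis
    using assms by (simp add: N.rsmult_one)
qed

text \<open>In both bimodules \<open>S\<close> acts on the right through \<open>\<phi>\<close>, so
  right \<open>S\<close>-linearity is \<open>lift_rsmult\<close> at elements
  \<open>\<phi> a\<close>.\<close>

lemma lift_hom: "lift \<in> bimodule_hom S S (restrict_scalars \<phi> N) (ring_bimodule R \<phi> \<phi>)"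
  by (auto simp: bimodule_hom_def restrict_scalars_def ring_bimodule_def hom_def
      lift_closed lift_add lift_smult lift_rsmult)

end

end

theorem corollary5p3:
  fixes S :: "('s, 'p) ring_scheme" and R :: "('r, 'q) ring_scheme"
    and \<phi> :: "'s \<Rightarrow> 'r" and E :: "'r \<Rightarrow> 's" and n :: nat and x y :: "nat \<Rightarrow> 'r"
  assumes "frobenius_extension S R \<phi> E n x y"
  shows "right_approximation S S
    (restriction_image S R \<phi> :: ('s, 's, 'r) bimodule set)
    (restriction_image S R \<phi> :: ('s, 's, 'n) bimodule set)
    (ring_bimodule R \<phi> \<phi>) (ring_bimodule S id id) E"
proof -
  interpret frobenius_extension S R \<phi> E n x y by fact
  \<comment> \<open>This (S,R)-bimodule is the witness that the domain of \<open>E\<close> lies in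
    the image of restriction.\<close>
  have "ring_bimodule R \<phi> id \<in> bimodules S R"
    using bimodule_ring_bimodule[OF ring_hom_ring_axioms ring_hom_ring_id[OF S.ring_axioms]]
    by (simp add: bimodules_def)
  then have R: "ring_bimodule R \<phi> \<phi> \<in> restriction_image S R \<phi>"
    unfolding restriction_image_def by (metis imageI restrict_scalars_ring_bimodule)
  have S: "ring_bimodule S id id \<in> bimodules S S"
    using bimodule_ring_bimodule ring_hom_ring_id[OF R.ring_axioms]
    by (auto simp: bimodules_def)
  have "\<exists>h\<in>bimodule_hom S S Y (ring_bimodule R \<phi> \<phi>). \<forall>v\<in>carrier Y. g v = E (h v)"
    if Y_image: "Y \<in> restriction_image S R \<phi>"
      and g: "g \<in> bimodule_hom S S Y (ring_bimodule S id id)"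
    for Y :: "('s, 's, 'n) bimodule" and g
  proof -
    obtain N where Y: "Y = restrict_scalars \<phi> N" and N: "bimodule S R N"
      using Y_image by (auto simp: restriction_image_def bimodules_def)
    have g': "g \<in> bimodule_hom S S (restrict_scalars \<phi> N) (ring_bimodule S id id)"
      using g Y by simp
    \<comment> \<open>Restriction keeps the carrier, so the lift built from \<open>N\<close> is
      defined on all of \<open>Y\<close>. Outside its context \<open>lift\<close> takes
      \<open>N\<close> and \<open>g\<close> as arguments.\<close>
    have "\<forall>v\<in>carrier Y. g v = E (lift N g v)"
      using E_lift[OF N g'] by (simp add: Y restrict_scalars_def)
    then show ?thesis
      using lift_hom[OF N g'] Y by blast
  qed
  with R S E_hom show ?thesis
    by (simp add: right_approximation_def restriction_image_subset_bimodules ring_hom_ring_axioms)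
qed

end
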